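(* Let $d\ge1$, let $\|\cdot\|$ be a norm on $\mathbb{R}^d$ with unit ball $B(0,1)$, and let $\omega$ be a modulus of continuity. Then the associated uncentered maximal operator $M$ acting on $\operatorname{Lip}(\omega)=\operatorname{Lip}(\omega,\mathbb{R}^d)$ has norm $$\|M\|_{\operatorname{Op}(\omega)}=\sup_{t>0}\ \sup_{\{v\in\mathbb{R}^d:\|v\|=1\}}\ \inf_{\{c\in\mathbb{R}^d,\,0<R\le1:\ \|v-c\|=R\}}\ \frac1{\omega(t)}\int_{B(0,1)}\omega\big(t\|c+Ru\|\big)\,\frac{du}{|B(0,1)|}.$$
   Context: For a norm $\|\cdot\|$ on $\mathbb{R}^d$ and a locally integrable $f:\mathbb{R}^d\to\mathbb{R}$, the uncentered Hardy-Littlewood maximal function is $Mf(x)=\sup_{B\ni x}\frac1{|B|}\int_B|f(y)|\,dy\in[0,\infty]$, the supremum being over all balls $B$ (of positive finite radius) with respect to $\|\cdot\|$ containing $x$; $|B|$ is Lebesgue measure. A modulus of continuity is a function $\omega:[0,\infty)\to[0,\infty)$ that is continuous, nondecreasing, subadditive, with $\omega(0)=0$, and not identically zero. For $f:\mathbb{R}^d\to\mathbb{R}$ let $\|f\|_{\operatorname{Lip}(\omega)}=\sup_{x\ne y}\frac{|f(x)-f(y)|}{\omega(\|x-y\|)}$; the space $\operatorname{Lip}(\omega)$ consists of the $f$ for which this seminorm is finite. The operator norm is $$\|M\|_{\operatorname{Op}(\omega)}=\sup\Big\{\frac{\|Mf\|_{\operatorname{Lip}(\omega)}}{\|f\|_{\operatorname{Lip}(\omega)}}: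 f\in\operatorname{Lip}(\omega),\ \|f\|_{\operatorname{Lip}(\omega)}\ne0\Big\}.$$ The same norm $\|\cdot\|$ is used for distances and for the balls defining $M$. If $Mf\equiv\infty$, it is regarded as constant, i.e. $\|Mf\|_{\operatorname{Lip}(\omega)}=0$. *)

theory Defs
  imports "HOL-Analysis.Analysis"
begin

definition is_norm :: "('a::real_vector \<Rightarrow> real) \<Rightarrow> bool" where
  "is_norm N \<longleftrightarrow>
     (\<forall>x. 0 \<le> N x) \<and>
     (\<forall>x. N x = 0 \<longleftrightarrow> x = 0) \<and>
     (\<forall>a x. N (a *\<^sub>R x) = \<bar>a\<bar> * N x) \<and>
     (\<forall>x y. N (x + y) \<le> N x + N y)"

(* Balls are closed. Averages over the open and the closed ball with the same centre and radius
   agree (the boundary is a null set), and using open balls instead gives the same maximal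
   function: a closed ball containing x is the limit of the concentric larger open balls. *)
definition norm_ball :: "('a::real_vector \<Rightarrow> real) \<Rightarrow> 'a \<Rightarrow> real \<Rightarrow> 'a set" where
  "norm_ball N c r = {y. N (y - c) \<le> r}"

definition maximal_function ::
    "('a::euclidean_space \<Rightarrow> real) \<Rightarrow> ('a \<Rightarrow> real) \<Rightarrow> 'a \<Rightarrow> ennreal" where
  "maximal_function N f x =
     (SUP (c, r) \<in> {(c, r). 0 < r \<and> x \<in> norm_ball N c r}.
        (\<integral>\<^sup>+ y \<in> norm_ball N c r. ennreal \<bar>f y\<bar> \<partial>lebesgue) / emeasure lebesgue (norm_ball N c r))"

(* A function on [0, oo) is represented by a total function on the reals;
   its values at negative arguments are irrelevant. *)
definition modulus_of_continuity :: "(real \<Rightarrow> real) \<Rightarrow> bool" where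
  "modulus_of_continuity \<omega> \<longleftrightarrow>
     (\<forall>t\<ge>0. 0 \<le> \<omega> t) \<and>
     continuous_on {0..} \<omega> \<and>
     mono_on {0..} \<omega> \<and>
     (\<forall>s\<ge>0. \<forall>t\<ge>0. \<omega> (s + t) \<le> \<omega> s + \<omega> t) \<and>
     \<omega> 0 = 0 \<and>
     (\<exists>t\<ge>0. \<omega> t \<noteq> 0)"

(* Defined for extended-real-valued functions so that it applies both to real functions f and to
   the [0, oo]-valued Mf. A function identically oo counts as constant. If g takes the value oo
   but is not identically oo, the supremum is oo (for ereal, also oo - oo = oo). *)
definition lip_seminorm ::
    "('a::real_vector \<Rightarrow> real) \<Rightarrow> (real \<Rightarrow> real) \<Rightarrow> ('a \<Rightarrow> ereal) \<Rightarrow> ereal" where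
  "lip_seminorm N \<omega> g =
     (if \<forall>x. g x = \<infinity> then 0
      else SUP (x, y) \<in> {(x, y). x \<noteq> y}. \<bar>g x - g y\<bar> / ereal (\<omega> (N (x - y))))"

definition lip_space :: "('a::real_vector \<Rightarrow> real) \<Rightarrow> (real \<Rightarrow> real) \<Rightarrow> ('a \<Rightarrow> real) set" where
  "lip_space N \<omega> = {f. lip_seminorm N \<omega> (\<lambda>x. ereal (f x)) < \<infinity>}"

definition maximal_op_norm :: "('a::euclidean_space \<Rightarrow> real) \<Rightarrow> (real \<Rightarrow> real) \<Rightarrow> ereal" where
  "maximal_op_norm N \<omega> =
     Sup {lip_seminorm N \<omega> (\<lambda>x. enn2ereal (maximal_function N f x)) /
            lip_seminorm N \<omega> (\<lambda>x. ereal (f x)) | f.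
          f \<in> lip_space N \<omega> \<and> lip_seminorm N \<omega> (\<lambda>x. ereal (f x)) \<noteq> 0}"

end

theory Submission
  imports Defs
begin

text \<open>Upper bound: let \<open>y\<close> and \<open>x = y + t v\<close> be given, and let \<open>B(c, R)\<close> have \<open>v\<close> on its boundary.
  Each ball \<open>B(a, r)\<close> containing \<open>y\<close> is moved by \<open>a + r u \<mapsto> (a + t c) + (r + t R) u\<close> onto a ball
  containing \<open>x\<close>. The point with parameter \<open>u\<close> is displaced by \<open>t (c + R u)\<close>, so the averages of
  \<open>\<bar>f\<bar>\<close> differ by at most the average of \<open>\<omega>(t N(c + R u))\<close> times the seminorm of \<open>f\<close>.

  Lower bound: for \<open>f(z) = max 0 (K - \<omega>(N z))\<close> with \<open>K = \<omega>(3t)\<close> the maximal function at \<open>0\<close> is \<open>K\<close>,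
  whereas at \<open>t v\<close> it is \<open>K\<close> minus the infimum of the averages of \<open>min K (\<omega> \<circ> N)\<close> over all balls
  containing \<open>t v\<close>. That infimum is not smaller than the one over balls of radius at most \<open>t\<close> with
  \<open>t v\<close> on the boundary: a smaller ball is contracted towards the origin until its boundary
  meets \<open>t v\<close>, and a larger one is compared with the ball of radius \<open>t\<close> about the origin.\<close>

section \<open>Arbitrary norms on a Euclidean space and their balls\<close>

lemma is_norm_nonneg: "is_norm N \<Longrightarrow> 0 \<le> N x"
  and is_norm_zero_iff: "is_norm N \<Longrightarrow> N x = 0 \<longleftrightarrow> x = 0"
  and is_norm_scaleR: "is_norm N \<Longrightarrow> N (a *\<^sub>R x) = \<bar>a\<bar> * N x"
  and is_norm_triangle: "is_norm N \<Longrightarrow> N (x + y) \<le> N x + N y"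
  by (auto simp: is_norm_def)

lemma is_norm_minus: "is_norm N \<Longrightarrow> N (- x) = N x"
  using is_norm_scaleR[of N "-1" x] by simp

lemma is_norm_minus_commute: "is_norm N \<Longrightarrow> N (x - y) = N (y - x)"
  using is_norm_minus[of N "x - y"] by simp

lemma is_norm_diff_le: "is_norm N \<Longrightarrow> \<bar>N x - N y\<bar> \<le> N (x - y)"
  using is_norm_triangle[of N "x - y" y] is_norm_triangle[of N "y - x" x]
    is_norm_minus_commute[of N x y] by auto

text \<open>Expansion in the basis bounds \<open>N x\<close> by the sum of
  \<open>\<bar>x \<bullet> b\<bar> * N b\<close>, and each coordinate is at most
  \<open>norm x\<close>.\<close>

lemma is_norm_bounded_by_norm:
  fixes N :: "'a::euclidean_space \<Rightarrow> real"
  assumes N: "is_norm N"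
  obtains C where "0 < C" "\<And>x. N x \<le> C * norm x"
proof
  let ?C = "(\<Sum>b\<in>Basis. N b) + 1"
  show "0 < ?C" using N by (simp add: add_nonneg_pos is_norm_nonneg sum_nonneg)
  fix x :: 'a
  have N_sum: "N (\<Sum>b\<in>S. g b) \<le> (\<Sum>b\<in>S. N (g b))" if "finite S" for S and g :: "'a \<Rightarrow> 'a"
    using that
  proof (induction S)
    case empty
    then show ?case using is_norm_zero_iff[OF N, of 0] by simp
  next
    case (insert a F)
    then show ?case using is_norm_triangle[OF N, of "g a" "sum g F"] by simp
  qed
  have "N x = N (\<Sum>b\<in>Basis. (x \<bullet> b) *\<^sub>R b)" by (simp add: euclidean_representation)
  also have "\<dots> \<le> (\<Sum>b\<in>Basis. N ((x \<bullet> b) *\<^sub>R b))" by (rule N_sum) simp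
  also have "\<dots> \<le> (\<Sum>b\<in>Basis. norm x * N b)"
    by (intro sum_mono)
      (simp add: is_norm_scaleR[OF N] mult_right_mono Basis_le_norm is_norm_nonneg[OF N])
  also have "\<dots> \<le> ?C * norm x" by (simp add: sum_distrib_left[symmetric] distrib_left mult.commute[of _ "norm x"])
  finally show "N x \<le> ?C * norm x" .
qed

lemma continuous_on_is_norm:
  fixes N :: "'a::euclidean_space \<Rightarrow> real"
  assumes N: "is_norm N"
  shows "continuous_on S N"
proof -
  obtain C where C: "0 < C" "\<And>x. N x \<le> C * norm x" using is_norm_bounded_by_norm[OF N] by metis
  have "C-lipschitz_on S N"
    using C is_norm_diff_le[OF N]
    by (intro lipschitz_onI) (auto simp: dist_norm intro: order_trans less_imp_le)
  then show ?thesis by (rule lipschitz_on_continuous_on)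
qed

lemma continuous_on_is_norm_compose:
  fixes N :: "'a::euclidean_space \<Rightarrow> real"
  assumes "is_norm N" "continuous_on S f"
  shows "continuous_on S (\<lambda>x. N (f x))"
  using continuous_on_compose2[OF continuous_on_is_norm[OF assms(1), of UNIV] assms(2)] by simp

text \<open>\<open>N\<close> is continuous and positive on the compact Euclidean unit sphere, so its
  minimum there serves as \<open>m\<close>; homogeneity does the rest. This is what makes norm balls
  bounded.\<close>

lemma is_norm_bounds_norm:
  fixes N :: "'a::euclidean_space \<Rightarrow> real"
  assumes N: "is_norm N"
  obtains m where "0 < m" "\<And>x. m * norm x \<le> N x"
proof -
  have "sphere (0::'a) 1 \<noteq> {}" by simp
  then obtain s where s: "s \<in> sphere 0 1" "\<And>y. y \<in> sphere 0 1 \<Longrightarrow> N s \<le> N y"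
    using continuous_attains_inf[OF compact_sphere _ continuous_on_is_norm[OF N]] by metis
  have "0 < N s"
    using s(1) is_norm_nonneg[OF N, of s] is_norm_zero_iff[OF N, of s] by fastforce
  moreover have "N s * norm x \<le> N x" for x
  proof (cases "x = 0")
    case True
    then show ?thesis using is_norm_nonneg[OF N, of x] by simp
  next
    case False
    then have "N s \<le> N (x /\<^sub>R norm x)" by (intro s(2)) simp
    then show ?thesis using False by (simp add: is_norm_scaleR[OF N] field_simps)
  qed
  ultimately show thesis using that by blast
qed

lemma compact_norm_ball:
  fixes N :: "'a::euclidean_space \<Rightarrow> real"
  assumes N: "is_norm N"
  shows "compact (norm_ball N c r)"
proof -
  obtain m where m: "0 < m" "\<And>x. m * norm x \<le> N x" using is_norm_bounds_norm[OF N] by metis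
  have "norm_ball N c r \<subseteq> cball c (r / m)"
    unfolding norm_ball_def using m(1) order_trans[OF m(2)]
    by (auto simp: dist_norm norm_minus_commute field_simps)
  moreover have "closed (norm_ball N c r)"
    unfolding norm_ball_def by (intro closed_Collect_le continuous_on_is_norm_compose[OF N] continuous_intros)
  ultimately show ?thesis
    by (meson bounded_cball bounded_subset compact_eq_bounded_closed)
qed

lemma sets_norm_ball:
  fixes N :: "'a::euclidean_space \<Rightarrow> real"
  assumes N: "is_norm N"
  shows "norm_ball N c r \<in> sets borel"
  by (simp add: N borel_compact compact_norm_ball)

text \<open>A Euclidean ball of radius \<open>1 / C\<close> fits inside.\<close>

lemma measure_unit_norm_ball_pos:
  fixes N :: "'a::euclidean_space \<Rightarrow> real"
  assumes N: "is_norm N"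
  shows "0 < measure lborel (norm_ball N 0 1)"
proof -
  obtain C where C: "0 < C" "\<And>x. N x \<le> C * norm x" using is_norm_bounded_by_norm[OF N] by metis
  have "ball 0 (1 / C) \<subseteq> norm_ball N 0 1"
  proof
    fix x :: 'a assume "x \<in> ball 0 (1 / C)"
    then have "C * norm x \<le> 1" using C(1) by (simp add: field_simps)
    then show "x \<in> norm_ball N 0 1" using C(2)[of x] by (simp add: norm_ball_def)
  qed
  then have "measure lborel (ball (0::'a) (1 / C)) \<le> measure lborel (norm_ball N 0 1)"
    by (intro measure_mono_fmeasurable)
      (auto intro!: fmeasurable_compact compact_norm_ball N)
  moreover have "0 < measure lborel (ball (0::'a) (1 / C))"
    using content_ball_pos[of "1/C" "0::'a"] C(1) by simp
  ultimately show ?thesis by linarith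
qed

section \<open>Averages over norm balls, all pulled back to the unit ball\<close>

definition ball_average :: "('a::euclidean_space \<Rightarrow> real) \<Rightarrow> ('a \<Rightarrow> real) \<Rightarrow> real" where
  "ball_average N g =
     (LINT u : norm_ball N 0 1 | lebesgue. g u) / measure lebesgue (norm_ball N 0 1)"

context
  fixes N :: "'a::euclidean_space \<Rightarrow> real"
  assumes N: "is_norm N"
begin

text \<open>Continuous functions and norm balls are Borel, so completing the measure does not change
  the integral; the affine and translation rules below are applied to \<open>lborel\<close>.\<close>

lemma ball_average_lborel:
  assumes "continuous_on UNIV g"
  shows "ball_average N g =
    (LINT u : norm_ball N 0 1 | lborel. g u) / measure lborel (norm_ball N 0 1)"
proof -
  have [measurable]: "g \<in> borel_measurable borel"
    using assms by (rule borel_measurable_continuous_onI)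
  note sets_norm_ball[OF N, measurable]
  show ?thesis
    unfolding ball_average_def set_lebesgue_integral_def
    by (subst integral_completion) auto
qed

lemma set_integrable_norm_ball:
  fixes g :: "'a \<Rightarrow> real"
  assumes "continuous_on UNIV g"
  shows "set_integrable lborel (norm_ball N c r) g"
  unfolding set_integrable_def
  using borel_integrable_compact[OF compact_norm_ball[OF N] continuous_on_subset[OF assms subset_UNIV]]
  by (simp add: indicator_def if_distrib cong: if_cong)

lemma ball_average_mono:
  assumes "continuous_on UNIV g" "continuous_on UNIV h"
    and "\<And>u. N u \<le> 1 \<Longrightarrow> g u \<le> h u"
  shows "ball_average N g \<le> ball_average N h"
  unfolding ball_average_lborel[OF assms(1)] ball_average_lborel[OF assms(2)]
  using assms
  by (intro divide_right_mono set_integral_mono set_integrable_norm_ball)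
    (auto simp: norm_ball_def)

lemma ball_average_const: "ball_average N (\<lambda>_. k) = k"
  using measure_unit_norm_ball_pos[OF N] ball_average_lborel[of "\<lambda>_. k"]
    fmeasurable_compact[OF compact_norm_ball[OF N, of 0 1]]
  by (simp add: set_lebesgue_integral_def fmeasurable_def)

lemma ball_average_add:
  assumes "continuous_on UNIV g" "continuous_on UNIV h"
  shows "ball_average N (\<lambda>u. g u + h u) = ball_average N g + ball_average N h"
  using assms
  by (simp add: ball_average_lborel continuous_on_add set_integral_add
      set_integrable_norm_ball add_divide_distrib)

lemma ball_average_cmult:
  assumes "continuous_on UNIV g"
  shows "ball_average N (\<lambda>u. k * g u) = k * ball_average N g"
  using assms by (simp add: ball_average_lborel continuous_on_mult_left)

lemma ball_average_nonneg:
  assumes "continuous_on UNIV g" "\<And>u. N u \<le> 1 \<Longrightarrow> 0 \<le> g u"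
  shows "0 \<le> ball_average N g"
  using ball_average_mono[of "\<lambda>_. 0" g] assms ball_average_const[of 0] by simp

text \<open>Substituting \<open>y = c + r *\<^sub>R u\<close> multiplies numerator and denominator
  by \<open>r ^ DIM('a)\<close>, which cancels.\<close>

lemma nn_integral_norm_ball_average:
  assumes g: "continuous_on UNIV g" "\<And>x. 0 \<le> g x" and r: "0 < r"
  shows "(\<integral>\<^sup>+ y \<in> norm_ball N c r. ennreal (g y) \<partial>lebesgue) / emeasure lebesgue (norm_ball N c r)
    = ennreal (ball_average N (\<lambda>u. g (c + r *\<^sub>R u)))"
proof -
  note sets_norm_ball[OF N, measurable]
  have ind: "indicator (norm_ball N c r) (c + r *\<^sub>R u) = (indicator (norm_ball N 0 1) u :: ennreal)" for u
    using r by (simp add: indicator_def norm_ball_def is_norm_scaleR[OF N])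
  \<comment> \<open>Used twice below: with \<open>h = 1\<close> for the measure of the ball and with
    \<open>h = g\<close> for the integral.\<close>
  have scale: "(\<integral>\<^sup>+ y \<in> norm_ball N c r. ennreal (h y) \<partial>lborel) =
      ennreal (r ^ DIM('a)) * ennreal (LINT u : norm_ball N 0 1 | lborel. h (c + r *\<^sub>R u))"
    if h: "continuous_on UNIV h" "\<And>x. 0 \<le> h x" for h :: "'a \<Rightarrow> real"
  proof -
    have [measurable]: "h \<in> borel_measurable borel"
      using h(1) by (rule borel_measurable_continuous_onI)
    have cont: "continuous_on UNIV (\<lambda>u. h (c + r *\<^sub>R u))"
      by (intro continuous_on_compose2[OF h(1)] continuous_intros) auto
    have "(\<integral>\<^sup>+ y \<in> norm_ball N c r. ennreal (h y) \<partial>lborel) =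
        (\<integral>\<^sup>+ u. ennreal (r ^ DIM('a)) * (ennreal (h (c + r *\<^sub>R u)) * indicator (norm_ball N 0 1) u) \<partial>lborel)"
      using r
      by (subst lborel_affine[of r c])
        (simp_all add: nn_integral_density nn_integral_distr ind ennreal_power)
    also have "\<dots> = ennreal (r ^ DIM('a)) *
        (\<integral>\<^sup>+ u. ennreal (indicator (norm_ball N 0 1) u * h (c + r *\<^sub>R u)) \<partial>lborel)"
      by (subst nn_integral_cmult)
        (auto intro!: nn_integral_cong arg_cong2[where f="(*)"] simp: indicator_def)
    also have "(\<integral>\<^sup>+ u. ennreal (indicator (norm_ball N 0 1) u * h (c + r *\<^sub>R u)) \<partial>lborel) =
        ennreal (LINT u : norm_ball N 0 1 | lborel. h (c + r *\<^sub>R u))"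
      using set_integrable_norm_ball[OF cont, of 0 1] h(2)
      unfolding set_lebesgue_integral_def set_integrable_def
      by (subst nn_integral_eq_integral) auto
    finally show ?thesis .
  qed
  have cont: "continuous_on UNIV (\<lambda>u. g (c + r *\<^sub>R u))"
    by (intro continuous_on_compose2[OF g(1)] continuous_intros) auto
  let ?V = "measure lborel (norm_ball N 0 1)"
  have "emeasure lebesgue (norm_ball N c r) = ennreal (r ^ DIM('a)) * ennreal ?V"
    using scale[of "\<lambda>_. 1"] fmeasurable_compact[OF compact_norm_ball[OF N, of 0 1]]
    by (simp add: set_lebesgue_integral_def fmeasurable_def)
  moreover have "(\<integral>\<^sup>+ y \<in> norm_ball N c r. ennreal (g y) \<partial>lebesgue) =
     ennreal (r ^ DIM('a)) * ennreal (LINT u : norm_ball N 0 1 | lborel. g (c + r *\<^sub>R u))"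
    using scale[OF g] by (simp add: nn_integral_completion)
  moreover have "0 \<le> (LINT u : norm_ball N 0 1 | lborel. g (c + r *\<^sub>R u))"
    unfolding set_lebesgue_integral_def using g(2) by (intro integral_nonneg_AE) auto
  ultimately show ?thesis
    using r measure_unit_norm_ball_pos[OF N]
    by (simp add: ball_average_lborel[OF cont] ennreal_mult[symmetric] divide_ennreal)
qed

text \<open>Bathtub principle: with \<open>\<psi> = \<phi> \<circ> N - \<phi> 1\<close>, the difference of the indicators of \<open>b + B\<close> and
  \<open>B\<close> times \<open>\<psi>\<close> is pointwise nonnegative, because \<open>\<psi> \<le> 0\<close> inside \<open>B\<close> and \<open>\<psi> \<ge> 0\<close> outside.\<close>
lemma ball_average_translate_ge:
  assumes cont: "continuous_on {0..} \<phi>" and mono: "mono_on {0..} \<phi>"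
  shows "ball_average N (\<lambda>u. \<phi> (N u)) \<le> ball_average N (\<lambda>u. \<phi> (N (b + u)))"
proof -
  note sets_norm_ball[OF N, measurable]
  have contN: "continuous_on UNIV (\<lambda>u. \<phi> (N (f u)))" if "continuous_on UNIV f" for f
    by (rule continuous_on_compose2[OF cont])
      (use continuous_on_is_norm_compose[OF N that] in \<open>auto simp: is_norm_nonneg[OF N]\<close>)
  let ?B = "norm_ball N 0 1" and ?B' = "norm_ball N b 1"
  let ?\<psi> = "\<lambda>z. \<phi> (N z) - \<phi> 1"
  have cont\<psi>: "continuous_on UNIV ?\<psi>" by (intro continuous_intros contN)
  have int: "set_integrable lborel (norm_ball N c 1) ?\<psi>" for c
    by (rule set_integrable_norm_ball[OF cont\<psi>])
  have "indicator ?B u *\<^sub>R ?\<psi> u \<le> indicator ?B' u *\<^sub>R ?\<psi> u" for u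
    using mono_onD[OF mono, of "N u" 1] mono_onD[OF mono, of 1 "N u"]
    by (auto simp: indicator_def norm_ball_def is_norm_nonneg[OF N])
  then have "(LINT u:?B|lborel. ?\<psi> u) \<le> (LINT u:?B'|lborel. ?\<psi> u)"
    using int unfolding set_lebesgue_integral_def set_integrable_def
    by (intro integral_mono) auto
  also have "\<dots> = (LINT u:?B|lborel. ?\<psi> (b + u))"
  proof -
    have [measurable]: "?\<psi> \<in> borel_measurable borel"
      using cont\<psi> by (rule borel_measurable_continuous_onI)
    have "(LINT u|lborel. indicator ?B' u *\<^sub>R ?\<psi> u) =
        (LINT u|distr lborel borel ((+) b). indicator ?B' u *\<^sub>R ?\<psi> u)"
      by (simp add: lborel_distr_plus)
    also have "\<dots> = (LINT u|lborel. indicator ?B' (b + u) *\<^sub>R ?\<psi> (b + u))"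
      by (intro integral_distr) auto
    finally show ?thesis
      by (simp add: set_lebesgue_integral_def indicator_def norm_ball_def)
  qed
  finally have "ball_average N ?\<psi> \<le> ball_average N (\<lambda>u. ?\<psi> (b + u))"
    by (subst (1 2) ball_average_lborel)
      (auto intro!: continuous_on_diff contN continuous_on_add continuous_on_const continuous_on_id
        divide_right_mono)
  then have "ball_average N (\<lambda>u. ?\<psi> u + \<phi> 1) \<le> ball_average N (\<lambda>u. ?\<psi> (b + u) + \<phi> 1)"
    by (subst (1 2) ball_average_add)
      (auto intro!: continuous_on_diff contN continuous_on_add continuous_on_const continuous_on_id)
  then show ?thesis by simp
qed

text \<open>With every average written over the same unit ball, averages over two different balls
  can be compared pointwise in \<open>u\<close>.\<close>

lemma maximal_function_ball_average:
  assumes "continuous_on UNIV f"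
  shows "maximal_function N f x =
    (SUP (c, r) \<in> {(c, r). 0 < r \<and> N (x - c) \<le> r}. ennreal (ball_average N (\<lambda>u. \<bar>f (c + r *\<^sub>R u)\<bar>)))"
proof -
  have "continuous_on UNIV (\<lambda>x. \<bar>f x\<bar>)" using assms by (rule continuous_on_rabs)
  then show ?thesis
    unfolding maximal_function_def
    by (intro SUP_cong) (simp add: norm_ball_def, clarify, simp add: nn_integral_norm_ball_average)
qed

end

section \<open>Moduli of continuity\<close>

lemma modulus_mono: "modulus_of_continuity \<omega> \<Longrightarrow> 0 \<le> s \<Longrightarrow> s \<le> t \<Longrightarrow> \<omega> s \<le> \<omega> t"
  using mono_onD[of "{0..}" \<omega> s t] unfolding modulus_of_continuity_def by simp

lemma modulus_nonneg: "modulus_of_continuity \<omega> \<Longrightarrow> 0 \<le> t \<Longrightarrow> 0 \<le> \<omega> t"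
  unfolding modulus_of_continuity_def by auto

lemma modulus_zero: "modulus_of_continuity \<omega> \<Longrightarrow> \<omega> 0 = 0"
  unfolding modulus_of_continuity_def by auto

text \<open>A zero at some \<open>t > 0\<close> spreads by subadditivity to all multiples of
  \<open>t\<close> and by monotonicity to all of \<open>[0, \<infinity>)\<close>, although \<omega>
  does not vanish identically.\<close>

lemma modulus_pos:
  assumes \<omega>: "modulus_of_continuity \<omega>" and t: "0 < t"
  shows "0 < \<omega> t"
proof (rule ccontr)
  assume "\<not> 0 < \<omega> t"
  then have \<omega>t: "\<omega> t \<le> 0" by simp
  have multiple: "\<omega> (real n * t) \<le> 0" for n
  proof (induction n)
    case 0
    then show ?case using modulus_zero[OF \<omega>] by simp
  next
    case (Suc n)
    have "\<omega> (real n * t + t) \<le> \<omega> (real n * t) + \<omega> t"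
      using \<omega> t unfolding modulus_of_continuity_def by simp
    then show ?case using Suc \<omega>t by (simp add: algebra_simps)
  qed
  obtain s where s: "0 \<le> s" "\<omega> s \<noteq> 0" using \<omega> unfolding modulus_of_continuity_def by auto
  obtain n where "s < real n * t" using reals_Archimedean3[OF t] by blast
  then have "\<omega> s \<le> 0" using modulus_mono[OF \<omega> s(1), of "real n * t"] multiple[of n] by linarith
  then show False using modulus_nonneg[OF \<omega> s(1)] s(2) by simp
qed

text \<open>From \<open>s \<le> t + r\<close>, monotonicity and subadditivity give
  \<open>\<omega> s \<le> \<omega> t + \<omega> r\<close>; then exchange \<open>s\<close> and
  \<open>t\<close>.\<close>

lemma modulus_diff_le:
  assumes \<omega>: "modulus_of_continuity \<omega>" and "0 \<le> s" "0 \<le> t" "\<bar>s - t\<bar> \<le> r"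
  shows "\<bar>\<omega> s - \<omega> t\<bar> \<le> \<omega> r"
proof -
  have "\<omega> a \<le> \<omega> b + \<omega> r" if "0 \<le> a" "0 \<le> b" "a \<le> b + r" for a b
  proof -
    have "\<omega> a \<le> \<omega> (b + r)" using that by (intro modulus_mono[OF \<omega>])
    also have "\<dots> \<le> \<omega> b + \<omega> r" using \<omega> that assms unfolding modulus_of_continuity_def by simp
    finally show ?thesis .
  qed
  from this[of s t] this[of t s] assms show ?thesis by (simp add: abs_le_iff)
qed

lemma continuous_on_modulus:
  assumes "modulus_of_continuity \<omega>" "continuous_on S f" "\<And>x. x \<in> S \<Longrightarrow> 0 \<le> f x"
  shows "continuous_on S (\<lambda>x. \<omega> (f x))"
  by (rule continuous_on_compose2[of "{0..}" \<omega>]) (use assms in \<open>auto simp: modulus_of_continuity_def\<close>)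

section \<open>The inner infimum of the norm formula, and the Lipschitz seminorm\<close>

definition touching_inf :: "('a::euclidean_space \<Rightarrow> real) \<Rightarrow> (real \<Rightarrow> real) \<Rightarrow> real \<Rightarrow> 'a \<Rightarrow> ereal" where
  "touching_inf N \<omega> t v =
     (INF (c, R) \<in> {(c, R). 0 < R \<and> R \<le> 1 \<and> N (v - c) = R}.
        ereal (1 / \<omega> t * ball_average N (\<lambda>u. \<omega> (t * N (c + R *\<^sub>R u)))))"

context
  fixes N :: "'a::euclidean_space \<Rightarrow> real" and \<omega> :: "real \<Rightarrow> real"
  assumes N: "is_norm N" and \<omega>: "modulus_of_continuity \<omega>"
begin

lemma continuous_on_affine_modulus:
  assumes "0 \<le> t"
  shows "continuous_on UNIV (\<lambda>u. \<omega> (t * N (c + r *\<^sub>R u)))"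
  using assms
  by (intro continuous_on_modulus[OF \<omega>] continuous_on_mult continuous_on_const
      continuous_on_is_norm_compose[OF N] continuous_intros)
    (simp add: is_norm_nonneg[OF N])

lemma touching_inf_nonneg:
  assumes "0 < t"
  shows "0 \<le> touching_inf N \<omega> t v"
proof -
  have "0 \<le> ball_average N (\<lambda>u. \<omega> (t * N (c + R *\<^sub>R u)))" for c R
    using assms
    by (intro ball_average_nonneg[OF N] continuous_on_affine_modulus modulus_nonneg[OF \<omega>])
      (auto simp: is_norm_nonneg[OF N])
  then show ?thesis
    unfolding touching_inf_def using modulus_pos[OF \<omega> assms] by (auto intro!: INF_greatest)
qed

text \<open>The unit ball about the origin has \<open>v\<close> on its boundary, and the integrand
  on it is at most \<open>\<omega> t\<close>. Together with nonnegativity this makes the infimum a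
  real number.\<close>

lemma touching_inf_le_1:
  assumes "0 < t" "N v = 1"
  shows "touching_inf N \<omega> t v \<le> 1"
proof -
  have "ball_average N (\<lambda>u. \<omega> (t * N (0 + 1 *\<^sub>R u))) \<le> ball_average N (\<lambda>_. \<omega> t)"
    using assms
    by (intro ball_average_mono[OF N] continuous_on_affine_modulus continuous_on_const
        modulus_mono[OF \<omega>]) (simp_all add: is_norm_nonneg[OF N])
  then have "1 / \<omega> t * ball_average N (\<lambda>u. \<omega> (t * N (0 + 1 *\<^sub>R u))) \<le> 1"
    using modulus_pos[OF \<omega> assms(1)] by (simp add: ball_average_const[OF N] field_simps)
  then show ?thesis
    unfolding touching_inf_def using assms(2)
    by (intro INF_lower2[of "(0, 1)"]) (auto simp: one_ereal_def)
qed

lemma is_norm_exists_unit: obtains v where "N v = 1"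
proof -
  obtain b :: 'a where "b \<in> Basis" using nonempty_Basis by blast
  then have "0 < N b" using is_norm_nonneg[OF N, of b] is_norm_zero_iff[OF N, of b] by fastforce
  then have "N (b /\<^sub>R N b) = 1" by (simp add: is_norm_scaleR[OF N])
  then show thesis using that by blast
qed

lemma is_norm_pos: "x \<noteq> y \<Longrightarrow> 0 < N (x - y)"
  using is_norm_nonneg[OF N, of "x - y"] is_norm_zero_iff[OF N, of "x - y"] by auto

text \<open>\<open>0 \<le> L\<close> covers \<open>g\<close> identically \<infinity>, where the
  seminorm is 0 by convention; otherwise divide by \<open>\<omega> (N (x - y))\<close>, which is
  positive.\<close>

lemma lip_seminorm_leI:
  assumes "0 \<le> L" "\<And>x y. x \<noteq> y \<Longrightarrow> \<bar>g x - g y\<bar> \<le> ereal (L * \<omega> (N (x - y)))"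
  shows "lip_seminorm N \<omega> g \<le> ereal L"
proof -
  have "\<bar>g x - g y\<bar> / ereal (\<omega> (N (x - y))) \<le> ereal L" if "x \<noteq> y" for x y
    using assms(2)[OF that] modulus_pos[OF \<omega> is_norm_pos[OF that]]
    by (subst ereal_divide_le_pos) (simp_all add: mult.commute)
  then show ?thesis
    unfolding lip_seminorm_def using assms(1) by (auto intro!: SUP_least)
qed

lemma lip_seminorm_upper:
  assumes "\<not> (\<forall>x. g x = \<infinity>)" "x \<noteq> y"
  shows "\<bar>g x - g y\<bar> / ereal (\<omega> (N (x - y))) \<le> lip_seminorm N \<omega> g"
  unfolding lip_seminorm_def using assms by (auto intro!: SUP_upper2[of "(x, y)"])

text \<open>An \<open>ereal\<close> supremum over no pairs would be -\<infinity>, so a pair of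
  distinct points is exhibited: the origin and a unit vector.\<close>

lemma lip_seminorm_nonneg: "0 \<le> lip_seminorm N \<omega> g"
proof (cases "\<forall>x. g x = \<infinity>")
  case True
  then show ?thesis by (simp add: lip_seminorm_def)
next
  case False
  obtain v where "N v = 1" using is_norm_exists_unit .
  then have "v \<noteq> 0" using is_norm_zero_iff[OF N, of 0] by auto
  then have "0 \<le> \<bar>g v - g 0\<bar> / ereal (\<omega> (N (v - 0)))"
    using modulus_pos[OF \<omega> is_norm_pos[of v 0]] by simp
  also have "\<dots> \<le> lip_seminorm N \<omega> g"
    using lip_seminorm_upper[OF False \<open>v \<noteq> 0\<close>] .
  finally show ?thesis .
qed

lemma lip_seminormD:
  assumes "lip_seminorm N \<omega> (\<lambda>x. ereal (f x)) = ereal L"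
  shows "\<bar>f x - f y\<bar> \<le> L * \<omega> (N (x - y))"
proof (cases "x = y")
  case True
  then show ?thesis
    using modulus_zero[OF \<omega>] is_norm_zero_iff[OF N, of 0] by simp
next
  case False
  then have "\<bar>ereal (f x) - ereal (f y)\<bar> / ereal (\<omega> (N (x - y))) \<le> ereal L"
    using lip_seminorm_upper[of "\<lambda>x. ereal (f x)"] assms by simp
  then show ?thesis
    using modulus_pos[OF \<omega> is_norm_pos[OF False]] by (simp add: field_simps)
qed

text \<open>\<omega> is continuous with \<open>\<omega> 0 = 0\<close>, so the bound tends to 0 as
  \<open>y\<close> tends to \<open>x\<close>. Continuity is what the averaging lemmas ask of
  \<open>f\<close>.\<close>

lemma continuous_on_lip:
  assumes "\<And>x y. \<bar>f x - f y\<bar> \<le> L * \<omega> (N (x - y))"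
  shows "continuous_on UNIV f"
proof -
  have "(f \<longlongrightarrow> f x) (at x)" for x
  proof (rule Lim_transform_bound[where g = "\<lambda>y. L * \<omega> (N (y - x))", THEN LIM_zero_cancel])
    show "\<forall>\<^sub>F y in at x. norm (f y - f x) \<le> norm (L * \<omega> (N (y - x)))"
      by (intro always_eventually allI) (simp add: order_trans[OF assms abs_ge_self])
    have "continuous_on UNIV (\<lambda>y. L * \<omega> (N (y - x)))"
      by (intro continuous_on_mult continuous_on_const continuous_on_modulus[OF \<omega>]
          continuous_on_is_norm_compose[OF N] continuous_intros) (simp add: is_norm_nonneg[OF N])
    then have "((\<lambda>y. L * \<omega> (N (y - x))) \<longlongrightarrow> L * \<omega> (N (x - x))) (at x)"
      unfolding continuous_on_def by blast
    then show "((\<lambda>y. L * \<omega> (N (y - x))) \<longlongrightarrow> 0) (at x)"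
      using modulus_zero[OF \<omega>] is_norm_zero_iff[OF N, of 0] by simp
  qed
  then show ?thesis by (simp add: continuous_on_def)
qed

section \<open>Upper bound: moving balls from one point to another\<close>

text \<open>\<open>c\<close> and \<rho> play the roles of \<open>t c\<close> and \<open>t R\<close>
  in the outline. Stating the bound in \<open>ennreal\<close> keeps it valid where the maximal
  function is infinite.\<close>

lemma maximal_function_transport:
  assumes lip: "\<And>x y. \<bar>f x - f y\<bar> \<le> L * \<omega> (N (x - y))" and L: "0 \<le> L"
    and \<rho>: "0 \<le> \<rho>" "N (x - y - c) \<le> \<rho>"
  shows "maximal_function N f y \<le>
    maximal_function N f x + ennreal (L * ball_average N (\<lambda>u. \<omega> (N (c + \<rho> *\<^sub>R u))))"
proof -
  have cont: "continuous_on UNIV f" using lip by (rule continuous_on_lip)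
  have cont_f: "continuous_on UNIV (\<lambda>u. \<bar>f (a + r *\<^sub>R u)\<bar>)" for a r
    by (intro continuous_on_rabs continuous_on_compose2[OF cont] continuous_intros) auto
  have cont_\<omega>: "continuous_on UNIV (\<lambda>u. \<omega> (N (c + \<rho> *\<^sub>R u)))"
    using continuous_on_affine_modulus[of 1] by simp
  have nonneg: "0 \<le> ball_average N (\<lambda>u. \<bar>f (a + r *\<^sub>R u)\<bar>)" for a r
    by (intro ball_average_nonneg[OF N] cont_f) simp
  show ?thesis
    unfolding maximal_function_ball_average[OF N cont, of y]
  proof (rule SUP_least, clarify)
    fix a r assume r: "0 < r" "N (y - a) \<le> r"
    let ?avg = "ball_average N (\<lambda>u. \<bar>f ((a + c) + (r + \<rho>) *\<^sub>R u)\<bar>)"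
    let ?err = "L * ball_average N (\<lambda>u. \<omega> (N (c + \<rho> *\<^sub>R u)))"
    have err: "0 \<le> ?err"
      using L modulus_nonneg[OF \<omega>] is_norm_nonneg[OF N]
      by (intro mult_nonneg_nonneg ball_average_nonneg[OF N] cont_\<omega>) auto
    have "\<bar>f (a + r *\<^sub>R u)\<bar> \<le> \<bar>f ((a + c) + (r + \<rho>) *\<^sub>R u)\<bar> + L * \<omega> (N (c + \<rho> *\<^sub>R u))" for u
      using lip[of "(a + c) + (r + \<rho>) *\<^sub>R u" "a + r *\<^sub>R u"] by (simp add: algebra_simps)
    then have "ball_average N (\<lambda>u. \<bar>f (a + r *\<^sub>R u)\<bar>) \<le> ?avg + ?err"
      unfolding ball_average_cmult[OF N cont_\<omega>, symmetric]
      by (subst ball_average_add[OF N, symmetric])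
        (intro ball_average_mono[OF N] cont_f continuous_on_add continuous_on_mult_left cont_\<omega>)+
    then have "ennreal (ball_average N (\<lambda>u. \<bar>f (a + r *\<^sub>R u)\<bar>)) \<le> ennreal (?avg + ?err)"
      by (rule ennreal_leI)
    also have "\<dots> = ennreal ?avg + ennreal ?err" using err nonneg by simp
    also have "ennreal ?avg \<le> maximal_function N f x"
      unfolding maximal_function_ball_average[OF N cont, of x]
    proof (rule SUP_upper2[of "(a + c, r + \<rho>)"])
      have "N (x - (a + c)) \<le> N (y - a) + N (x - y - c)"
        using is_norm_triangle[OF N, of "y - a" "x - y - c"] by (simp add: algebra_simps)
      then show "(a + c, r + \<rho>) \<in> {(c, r). 0 < r \<and> N (x - c) \<le> r}" using r \<rho> by simp
    qed simp
    finally show "ennreal (ball_average N (\<lambda>u. \<bar>f (a + r *\<^sub>R u)\<bar>)) \<le> maximal_function N f x + ennreal ?err"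
      by (simp add: add_right_mono)
  qed
qed

text \<open>Finiteness is assumed at \<open>x\<close> and concluded at \<open>y\<close>, so that one
  finite value propagates to all points. The bound is one-sided; exchanging the points gives the
  other side.\<close>

lemma maximal_function_diff_le:
  assumes lip: "\<And>x y. \<bar>f x - f y\<bar> \<le> L * \<omega> (N (x - y))" and L: "0 < L"
    and C: "\<And>t v. 0 < t \<Longrightarrow> N v = 1 \<Longrightarrow> touching_inf N \<omega> t v \<le> ereal C"
    and "x \<noteq> y" and Mx: "maximal_function N f x = ennreal a" and a: "0 \<le> a"
  obtains b where "0 \<le> b" "maximal_function N f y = ennreal b" "b - a \<le> L * C * \<omega> (N (x - y))"
proof -
  let ?t = "N (x - y)"
  let ?v = "(x - y) /\<^sub>R ?t"
  have t: "0 < ?t" using \<open>x \<noteq> y\<close> by (rule is_norm_pos)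
  have v: "N ?v = 1" using t by (simp add: is_norm_scaleR[OF N])
  have step: "maximal_function N f y \<le> ennreal (a + L * ball_average N (\<lambda>u. \<omega> (?t * N (c + R *\<^sub>R u))))"
    if "0 < R" "N (?v - c) = R" for c R
  proof -
    have "x - y - ?t *\<^sub>R c = ?t *\<^sub>R (?v - c)" using t by (simp add: scaleR_diff_right)
    then have "N (x - y - ?t *\<^sub>R c) = ?t * R"
      using that t by (simp only: is_norm_scaleR[OF N] abs_of_pos[OF t])
    moreover have "N (?t *\<^sub>R c + (?t * R) *\<^sub>R u) = ?t * N (c + R *\<^sub>R u)" for u
      using is_norm_scaleR[OF N, of ?t "c + R *\<^sub>R u"] t by (simp add: scaleR_add_right)
    moreover have "0 \<le> ball_average N (\<lambda>u. \<omega> (?t * N (c + R *\<^sub>R u)))"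
      using t by (intro ball_average_nonneg[OF N] continuous_on_affine_modulus modulus_nonneg[OF \<omega>])
        (auto simp: is_norm_nonneg[OF N])
    ultimately show ?thesis
      using maximal_function_transport[OF lip, of "?t * R" x y "?t *\<^sub>R c"] L t that Mx a by simp
  qed
  \<comment> \<open>The unit ball about the origin (\<open>R = 1\<close>, \<open>c = 0\<close>)
    touches \<open>?v\<close>; this instance already shows finiteness at \<open>y\<close>.\<close>
  from step[of 1 0] v have "maximal_function N f y < top"
    using le_less_trans[OF _ ennreal_less_top] by auto
  then obtain b where b: "0 \<le> b" "maximal_function N f y = ennreal b"
    by (cases "maximal_function N f y") auto
  \<comment> \<open>After division by \<open>L * \<omega> ?t\<close> the left side is a lower bound
    for every term of the infimum, hence for \<open>touching_inf\<close>.\<close>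
  have "(b - a) / (L * \<omega> ?t) \<le> 1 / \<omega> ?t * ball_average N (\<lambda>u. \<omega> (?t * N (c + R *\<^sub>R u)))"
    if "0 < R" "N (?v - c) = R" for c R
  proof -
    have "0 \<le> ball_average N (\<lambda>u. \<omega> (?t * N (c + R *\<^sub>R u)))"
      using t by (intro ball_average_nonneg[OF N] continuous_on_affine_modulus modulus_nonneg[OF \<omega>])
        (auto simp: is_norm_nonneg[OF N])
    then have "0 \<le> a + L * ball_average N (\<lambda>u. \<omega> (?t * N (c + R *\<^sub>R u)))"
      using a L by simp
    then have "b \<le> a + L * ball_average N (\<lambda>u. \<omega> (?t * N (c + R *\<^sub>R u)))"
      using step[OF that] unfolding b(2) by (rule ennreal_le_iff[THEN iffD1])
    then have "(b - a) / (L * \<omega> ?t) \<le>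
        (L * ball_average N (\<lambda>u. \<omega> (?t * N (c + R *\<^sub>R u)))) / (L * \<omega> ?t)"
      using L modulus_pos[OF \<omega> t] by (intro divide_right_mono) auto
    then show ?thesis using L by simp
  qed
  then have "ereal ((b - a) / (L * \<omega> ?t)) \<le> touching_inf N \<omega> ?t ?v"
    unfolding touching_inf_def by (auto intro!: INF_greatest)
  also have "\<dots> \<le> ereal C" using C[OF t v] .
  finally have "b - a \<le> L * C * \<omega> ?t"
    using L modulus_pos[OF \<omega> t] by (simp add: field_simps)
  then show thesis using that b by blast
qed

text \<open>Either the maximal function is identically infinite, with seminorm 0 by convention, or
  one finite value forces finiteness everywhere and the one-sided estimate can be
  symmetrised.\<close>

lemma lip_seminorm_maximal_function_le:
  assumes lip: "\<And>x y. \<bar>f x - f y\<bar> \<le> L * \<omega> (N (x - y))" and L: "0 < L"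
    and C: "\<And>t v. 0 < t \<Longrightarrow> N v = 1 \<Longrightarrow> touching_inf N \<omega> t v \<le> ereal C" "0 \<le> C"
  shows "lip_seminorm N \<omega> (\<lambda>x. enn2ereal (maximal_function N f x)) \<le> ereal (L * C)"
proof (cases "\<forall>x. maximal_function N f x = top")
  case True
  then show ?thesis using L C(2) by (simp add: lip_seminorm_def)
next
  case False
  then obtain x0 a0 where x0: "maximal_function N f x0 = ennreal a0" "0 \<le> a0"
    by (metis ennreal_cases)
  have finite: "\<exists>b\<ge>0. maximal_function N f y = ennreal b" for y
  proof (cases "x0 = y")
    case True
    then show ?thesis using x0 by auto
  next
    case False
    show ?thesis by (rule maximal_function_diff_le[OF lip L C(1) False x0]) auto
  qed
  have half: "b - a \<le> L * C * \<omega> (N (x - y))"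
    if "x \<noteq> y" "0 \<le> a" "0 \<le> b" "maximal_function N f x = ennreal a" "maximal_function N f y = ennreal b"
    for x y a b
    using maximal_function_diff_le[OF lip L C(1) that(1,4,2)] that(3,5) by (metis ennreal_inj)
  show ?thesis
  proof (rule lip_seminorm_leI)
    fix x y :: 'a assume "x \<noteq> y"
    obtain a b where ab: "0 \<le> a" "0 \<le> b"
      "maximal_function N f x = ennreal a" "maximal_function N f y = ennreal b"
      using finite by metis
    have "\<bar>a - b\<bar> \<le> L * C * \<omega> (N (x - y))"
      using half[OF \<open>x \<noteq> y\<close> ab] half[OF \<open>x \<noteq> y\<close>[symmetric] ab(2,1,4,3)] is_norm_minus_commute[OF N, of x y]
      by (auto simp: abs_le_iff)
    then show "\<bar>enn2ereal (maximal_function N f x) - enn2ereal (maximal_function N f y)\<bar>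
        \<le> ereal (L * C * \<omega> (N (x - y)))"
      using ab by simp
  qed (use L C in simp)
qed

lemma maximal_op_norm_le:
  assumes C: "\<And>t v. 0 < t \<Longrightarrow> N v = 1 \<Longrightarrow> touching_inf N \<omega> t v \<le> ereal C" "0 \<le> C"
  shows "maximal_op_norm N \<omega> \<le> ereal C"
  unfolding maximal_op_norm_def
proof (rule Sup_least, clarify)
  fix f assume f: "f \<in> lip_space N \<omega>" "lip_seminorm N \<omega> (\<lambda>x. ereal (f x)) \<noteq> 0"
  \<comment> \<open>Membership in the space and the nonzero seminorm make it a positive real, so the
    quotient can be cleared.\<close>
  then obtain L where L: "lip_seminorm N \<omega> (\<lambda>x. ereal (f x)) = ereal L" "0 < L"
    using lip_seminorm_nonneg[of "\<lambda>x. ereal (f x)"]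
    by (cases "lip_seminorm N \<omega> (\<lambda>x. ereal (f x))") (auto simp: lip_space_def zero_ereal_def)
  show "lip_seminorm N \<omega> (\<lambda>x. enn2ereal (maximal_function N f x)) /
      lip_seminorm N \<omega> (\<lambda>x. ereal (f x)) \<le> ereal C"
    unfolding L(1)
  proof (rule ereal_divide_le_pos[THEN iffD2])
    show "lip_seminorm N \<omega> (\<lambda>x. enn2ereal (maximal_function N f x)) \<le> ereal L * ereal C"
      unfolding times_ereal.simps
      by (rule lip_seminorm_maximal_function_le[OF _ L(2) C]) (rule lip_seminormD[OF L(1)])
  qed (use L(2) in simp_all)
qed

section \<open>Lower bound: reduction to touching balls, and the extremal function\<close>

text \<open>The truncation at \<open>\<omega> (3 * t)\<close> does no harm: a point of a ball of
  radius \<open>R \<le> 1\<close> with \<open>v\<close> on its boundary has norm at most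
  \<open>N v + R + R \<le> 3\<close>.\<close>

lemma touching_ball_average_le:
  assumes t: "0 < t" and v: "N v = 1" and r: "0 < r" "N (t *\<^sub>R v - a) \<le> r"
  obtains c R where "0 < R" "R \<le> 1" "N (v - c) = R"
    "ball_average N (\<lambda>u. \<omega> (t * N (c + R *\<^sub>R u))) \<le>
     ball_average N (\<lambda>u. min (\<omega> (3 * t)) (\<omega> (N (a + r *\<^sub>R u))))"
proof (cases "r < t")
  case True
  have cont: "continuous_on UNIV (\<lambda>u. min (\<omega> (3 * t)) (\<omega> (N (a + r *\<^sub>R u))))"
    using continuous_on_affine_modulus[of 1 a r] by (intro continuous_on_min continuous_on_const) simp
  \<comment> \<open>A zero of \<open>?h\<close> in \<open>s\<close> means that
    \<open>t *\<^sub>R v\<close> lies on the boundary of the ball contracted by \<open>s\<close>.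
    The value is \<open>t\<close> at 0 and nonpositive at 1, so there is a zero, and it is not at
    0.\<close>
  let ?h = "\<lambda>s. N (t *\<^sub>R v - s *\<^sub>R a) - s * r"
  have "continuous_on {0..1} ?h"
    by (intro continuous_on_diff continuous_on_is_norm_compose[OF N] continuous_intros)
  moreover have "?h 1 \<le> 0" "0 \<le> ?h 0" using r t v by (simp_all add: is_norm_scaleR[OF N])
  ultimately obtain s where s: "0 \<le> s" "s \<le> 1" "?h s = 0"
    using IVT2'[of ?h 1 0 0] by auto
  have "s \<noteq> 0" using s(3) t v by (auto simp: is_norm_scaleR[OF N])
  then have "0 < s" using s by simp
  \<comment> \<open>The contracted ball \<open>B(s a, s r)\<close> divided by \<open>t\<close>, so
    that it touches \<open>v\<close>; \<open>r < t\<close> and \<open>s \<le> 1\<close> give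
    \<open>?R \<le> 1\<close>.\<close>
  let ?c = "(s / t) *\<^sub>R a" and ?R = "s * r / t"
  have "v - ?c = (1 / t) *\<^sub>R (t *\<^sub>R v - s *\<^sub>R a)" using t by (simp add: scaleR_diff_right)
  then have touch: "N (v - ?c) = ?R"
    using s(3) t by (simp only: is_norm_scaleR[OF N]) simp
  have R1: "?R \<le> 1"
    using True s r t mult_mono[of s 1 r t] by (simp add: field_simps)
  have R0: "0 < ?R" using \<open>0 < s\<close> r t by simp
  have norm_eq: "t * N (?c + ?R *\<^sub>R u) = s * N (a + r *\<^sub>R u)" for u
  proof -
    have "t *\<^sub>R (?c + ?R *\<^sub>R u) = s *\<^sub>R (a + r *\<^sub>R u)" using t by (simp add: scaleR_add_right)
    then show ?thesis
      using is_norm_scaleR[OF N, of t "?c + ?R *\<^sub>R u"] is_norm_scaleR[OF N, of s "a + r *\<^sub>R u"] t s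
      by simp
  qed
  have "ball_average N (\<lambda>u. \<omega> (t * N (?c + ?R *\<^sub>R u))) \<le>
     ball_average N (\<lambda>u. min (\<omega> (3 * t)) (\<omega> (N (a + r *\<^sub>R u))))"
  proof (rule ball_average_mono[OF N])
    fix u assume u: "N u \<le> 1"
    have "N (?c + ?R *\<^sub>R u) \<le> N ?c + N (?R *\<^sub>R u)" by (rule is_norm_triangle[OF N])
    also have "N (?R *\<^sub>R u) \<le> 1"
      using R0 R1 u is_norm_nonneg[OF N, of u] mult_mono[of ?R 1 "N u" 1]
      by (simp only: is_norm_scaleR[OF N] abs_of_pos[OF R0]) simp
    also have "N ?c \<le> N v + N (v - ?c)"
      using is_norm_triangle[OF N, of v "?c - v"] is_norm_minus_commute[OF N, of v ?c] by simp
    finally have "N (?c + ?R *\<^sub>R u) \<le> 3" using v touch R1 by linarith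
    then have "\<omega> (t * N (?c + ?R *\<^sub>R u)) \<le> \<omega> (3 * t)"
      using t by (intro modulus_mono[OF \<omega>]) (simp_all add: is_norm_nonneg[OF N])
    moreover have "\<omega> (s * N (a + r *\<^sub>R u)) \<le> \<omega> (N (a + r *\<^sub>R u))"
      using s is_norm_nonneg[OF N] by (intro modulus_mono[OF \<omega>]) (simp_all add: mult_left_le_one_le)
    ultimately show "\<omega> (t * N (?c + ?R *\<^sub>R u)) \<le> min (\<omega> (3 * t)) (\<omega> (N (a + r *\<^sub>R u)))"
      by (simp add: norm_eq)
  qed (use t cont continuous_on_affine_modulus[of t] in simp_all)
  then show thesis using that[OF R0 R1 touch] by blast
next
  case False
  \<comment> \<open>Radial profile of the truncated integrand once radius \<open>r\<close> is
    rescaled to 1; the centre becomes \<open>a /\<^sub>R r\<close>, and the bathtub principle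
    applies.\<close>
  let ?\<phi> = "\<lambda>x. min (\<omega> (3 * t)) (\<omega> (r * x))"
  have cont: "continuous_on {0..} ?\<phi>"
    using r by (intro continuous_on_min continuous_on_const continuous_on_modulus[OF \<omega>]
        continuous_intros) auto
  have mono: "mono_on {0..} ?\<phi>"
    using r by (intro mono_onI min.mono order_refl modulus_mono[OF \<omega>]) auto
  have norm_eq: "r * N (a /\<^sub>R r + u) = N (a + r *\<^sub>R u)" for u
    using is_norm_scaleR[OF N, of r "a /\<^sub>R r + u"] r by (simp add: scaleR_add_right)
  \<comment> \<open>Here \<open>t \<le> r\<close>, and the witness is the unit ball about the
    origin: on it \<open>t * N u\<close> is at most both \<open>3 * t\<close> and
    \<open>r * N u\<close>.\<close>
  have "ball_average N (\<lambda>u. \<omega> (t * N (0 + 1 *\<^sub>R u))) \<le> ball_average N (\<lambda>u. ?\<phi> (N u))"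
  proof (rule ball_average_mono[OF N])
    show "continuous_on UNIV (\<lambda>u. ?\<phi> (N u))"
      by (rule continuous_on_compose2[OF cont continuous_on_is_norm[OF N]])
        (auto simp: is_norm_nonneg[OF N])
    fix u assume "N u \<le> 1"
    then have "t * N u \<le> 3 * t" using t by simp
    moreover have "t * N u \<le> r * N u"
      using False is_norm_nonneg[OF N] by (intro mult_right_mono) auto
    ultimately show "\<omega> (t * N (0 + 1 *\<^sub>R u)) \<le> ?\<phi> (N u)"
      using t is_norm_nonneg[OF N] by (auto intro!: min.boundedI modulus_mono[OF \<omega>])
  qed (use t continuous_on_affine_modulus[of t 0 1] in simp)
  also have "\<dots> \<le> ball_average N (\<lambda>u. ?\<phi> (N (a /\<^sub>R r + u)))"
    by (rule ball_average_translate_ge[OF N cont mono])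
  finally show thesis using that[of 1 0] v by (simp add: norm_eq)
qed

text \<open>A single function of seminorm 1 suffices, whose maximal function drops by at least
  \<open>?I\<close> from \<open>0\<close> to \<open>t *\<^sub>R v\<close>, points at distance
  \<open>t\<close>.\<close>

lemma touching_inf_le_maximal_op_norm:
  assumes t: "0 < t" and v: "N v = 1"
  shows "touching_inf N \<omega> t v \<le> maximal_op_norm N \<omega>"
proof -
  obtain i where i: "touching_inf N \<omega> t v = ereal i" "0 \<le> i"
    using touching_inf_nonneg[OF t, of v] touching_inf_le_1[OF t v]
    by (cases "touching_inf N \<omega> t v") auto
  let ?K = "\<omega> (3 * t)" and ?I = "i * \<omega> t"
  \<comment> \<open>The maximum with 0 makes \<open>f\<close> nonnegative, so
    \<open>\<bar>f z\<bar> = ?K - min ?K (\<omega> (N z))\<close>.\<close>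
  define f where "f z = max 0 (?K - \<omega> (N z))" for z
  have \<omega>t: "0 < \<omega> t" using modulus_pos[OF \<omega> t] .
  have K: "0 < ?K" using modulus_pos[OF \<omega>, of "3 * t"] t by simp
  have N0: "N 0 = 0" using is_norm_zero_iff[OF N] by simp
  have f0: "f 0 = ?K" using K N0 modulus_zero[OF \<omega>] by (simp add: f_def)
  have lip: "\<bar>f x - f y\<bar> \<le> 1 * \<omega> (N (x - y))" for x y
  proof -
    have "\<bar>f x - f y\<bar> \<le> \<bar>\<omega> (N x) - \<omega> (N y)\<bar>" by (auto simp: f_def)
    also have "\<dots> \<le> \<omega> (N (x - y))"
      by (intro modulus_diff_le[OF \<omega>] is_norm_nonneg[OF N] is_norm_diff_le[OF N])
    finally show ?thesis by simp
  qed
  have cont: "continuous_on UNIV f" using lip by (rule continuous_on_lip)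
  have cont_f: "continuous_on UNIV (\<lambda>u. \<bar>f (a + r *\<^sub>R u)\<bar>)" for a r
    by (intro continuous_on_rabs continuous_on_compose2[OF cont] continuous_intros) auto
  have v0: "v \<noteq> 0" using v N0 by auto
  have seminorm: "lip_seminorm N \<omega> (\<lambda>x. ereal (f x)) = 1"
  proof (rule antisym)
    show "lip_seminorm N \<omega> (\<lambda>x. ereal (f x)) \<le> 1"
      unfolding one_ereal_def using lip by (intro lip_seminorm_leI) auto
    \<comment> \<open>The value 1 is attained between 0 and a point at distance
      \<open>3 * t\<close>, where \<open>f\<close> has fallen from \<open>?K\<close> to 0.\<close>
    have Nv: "N ((3 * t) *\<^sub>R v) = 3 * t" using t v by (simp add: is_norm_scaleR[OF N])
    then have "f ((3 * t) *\<^sub>R v) = 0" by (simp add: f_def)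
    then have "1 = \<bar>ereal (f ((3 * t) *\<^sub>R v)) - ereal (f 0)\<bar> / ereal (\<omega> (N ((3 * t) *\<^sub>R v - 0)))"
      using K f0 Nv by (simp add: one_ereal_def)
    also have "\<dots> \<le> lip_seminorm N \<omega> (\<lambda>x. ereal (f x))"
      using t v0 by (intro lip_seminorm_upper) auto
    finally show "1 \<le> lip_seminorm N \<omega> (\<lambda>x. ereal (f x))" .
  qed
  \<comment> \<open>Averages over balls of radius \<open>r\<close> about 0 are at least
    \<open>?K - \<omega> r\<close>; let \<open>r\<close> tend to 0.\<close>
  have M0: "maximal_function N f 0 \<ge> ennreal ?K"
  proof -
    have "ennreal (?K - \<omega> r) \<le> maximal_function N f 0" if "0 < r" for r
    proof -
      have "ball_average N (\<lambda>_. ?K - \<omega> r) \<le> ball_average N (\<lambda>u. \<bar>f (0 + r *\<^sub>R u)\<bar>)"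
      proof (rule ball_average_mono[OF N continuous_on_const cont_f])
        fix u assume "N u \<le> 1"
        then have "\<omega> (N (r *\<^sub>R u)) \<le> \<omega> r"
          using \<open>0 < r\<close> is_norm_nonneg[OF N] mult_left_mono[of "N u" 1 r]
          by (intro modulus_mono[OF \<omega>]) (auto simp: is_norm_scaleR[OF N])
        then show "?K - \<omega> r \<le> \<bar>f (0 + r *\<^sub>R u)\<bar>" by (auto simp: f_def)
      qed
      then show ?thesis
        unfolding maximal_function_ball_average[OF N cont] using \<open>0 < r\<close> N0
        by (intro SUP_upper2[of "(0, r)"]) (auto simp: ball_average_const[OF N] intro!: ennreal_leI)
    qed
    moreover have "((\<lambda>r. ennreal (?K - \<omega> r)) \<longlongrightarrow> ennreal (?K - \<omega> 0)) (at_right 0)"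
    proof (intro tendsto_ennrealI tendsto_diff tendsto_const)
      have "continuous_on {0..} \<omega>" using \<omega> by (simp add: modulus_of_continuity_def)
      then have "(\<omega> \<longlongrightarrow> \<omega> 0) (at 0 within {0..})" by (simp add: continuous_on_def)
      then show "(\<omega> \<longlongrightarrow> \<omega> 0) (at_right 0)" by (rule tendsto_within_subset) auto
    qed
    ultimately show ?thesis
      using modulus_zero[OF \<omega>]
      by (intro tendsto_upperbound[where F="at_right 0" and f="\<lambda>r. ennreal (?K - \<omega> r)"])
        (auto simp: eventually_at_filter)
  qed
  have Mv: "maximal_function N f (t *\<^sub>R v) \<le> ennreal (?K - ?I)"
    unfolding maximal_function_ball_average[OF N cont]
  proof (rule SUP_least, clarify, rule ennreal_leI)
    fix a r assume r: "0 < r" "N (t *\<^sub>R v - a) \<le> r"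
    let ?g = "\<lambda>u. min ?K (\<omega> (N (a + r *\<^sub>R u)))"
    obtain c R where cR: "0 < R" "R \<le> 1" "N (v - c) = R"
      "ball_average N (\<lambda>u. \<omega> (t * N (c + R *\<^sub>R u))) \<le> ball_average N ?g"
      using touching_ball_average_le[OF t v r] by metis
    have "ereal i \<le> ereal (1 / \<omega> t * ball_average N (\<lambda>u. \<omega> (t * N (c + R *\<^sub>R u))))"
      unfolding i(1)[symmetric] touching_inf_def using cR by (intro INF_lower2[of "(c, R)"]) auto
    then have "?I \<le> ball_average N ?g" using \<omega>t cR(4) by (simp add: field_simps)
    \<comment> \<open>\<open>\<bar>f\<bar>\<close> and the truncated integrand add up to the
      constant \<open>?K\<close>, so an upper bound for one average is a lower bound for the
      other.\<close>
    moreover have "ball_average N (\<lambda>u. \<bar>f (a + r *\<^sub>R u)\<bar>) + ball_average N ?g =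
        ball_average N (\<lambda>u. \<bar>f (a + r *\<^sub>R u)\<bar> + ?g u)"
      using continuous_on_affine_modulus[of 1 a r]
      by (intro ball_average_add[OF N, symmetric] cont_f continuous_on_min continuous_on_const) simp
    moreover have "\<bar>f (a + r *\<^sub>R u)\<bar> + ?g u = ?K" for u by (auto simp: f_def)
    ultimately show "ball_average N (\<lambda>u. \<bar>f (a + r *\<^sub>R u)\<bar>) \<le> ?K - ?I"
      by (simp add: ball_average_const[OF N])
  qed
  \<comment> \<open>Ensures \<open>?K - ?I \<ge> 0\<close>, so that \<open>ennreal\<close> does not
    cut the difference off at 0.\<close>
  have IK: "?I \<le> ?K"
  proof -
    have "i \<le> 1" using touching_inf_le_1[OF t v] i(1) by simp
    then have "?I \<le> \<omega> t" using \<omega>t by simp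
    also have "\<dots> \<le> ?K" using t by (intro modulus_mono[OF \<omega>]) auto
    finally show ?thesis .
  qed
  let ?M = "\<lambda>x. enn2ereal (maximal_function N f x)"
  have M0': "ereal ?K \<le> ?M 0" using M0 K by (simp add: less_eq_ennreal.rep_eq)
  have Mv': "?M (t *\<^sub>R v) \<le> ereal (?K - ?I)" using Mv IK by (simp add: less_eq_ennreal.rep_eq)
  \<comment> \<open>\<open>?M (t *\<^sub>R v)\<close> is finite; should \<open>?M 0\<close> be
    infinite, the difference is infinite as well.\<close>
  have "ereal ?I \<le> \<bar>?M (t *\<^sub>R v) - ?M 0\<bar>"
    using M0' Mv' enn2ereal_nonneg[of "maximal_function N f (t *\<^sub>R v)"]
    by (cases "?M (t *\<^sub>R v)"; cases "?M 0") auto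
  then have "ereal i \<le> \<bar>?M (t *\<^sub>R v) - ?M 0\<bar> / ereal (\<omega> (N (t *\<^sub>R v - 0)))"
    using \<omega>t t v by (subst ereal_le_divide_pos) (simp_all add: is_norm_scaleR[OF N] mult.commute)
  also have "\<dots> \<le> lip_seminorm N \<omega> ?M"
  proof (rule lip_seminorm_upper)
    \<comment> \<open>Excludes the convention that an identically infinite function has seminorm
      0.\<close>
    show "\<not> (\<forall>x. ?M x = \<infinity>)" using Mv' by (metis ereal_infty_less_eq(1) PInfty_neq_ereal(1))
    show "t *\<^sub>R v \<noteq> 0" using t v0 by simp
  qed
  also have "\<dots> = lip_seminorm N \<omega> ?M / lip_seminorm N \<omega> (\<lambda>x. ereal (f x))"
    by (simp add: seminorm)
  also have "\<dots> \<le> maximal_op_norm N \<omega>"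
    unfolding maximal_op_norm_def
    by (intro Sup_upper CollectI exI[of _ f]) (simp add: lip_space_def seminorm)
  finally show ?thesis by (simp add: i(1))
qed

section \<open>Combining the two bounds\<close>

theorem maximal_op_norm_eq:
  "maximal_op_norm N \<omega> = (SUP t \<in> {0<..}. SUP v \<in> {v. N v = 1}. touching_inf N \<omega> t v)"
    (is "_ = ?S")
proof (rule antisym)
  obtain v where v: "N v = 1" using is_norm_exists_unit .
  have upper: "touching_inf N \<omega> t v \<le> ?S" if "0 < t" "N v = 1" for t v
    using that by (auto intro!: SUP_upper2[of t] SUP_upper2[of v])
  \<comment> \<open>The double supremum lies in \<open>[0, 1]\<close>, hence is a real
    \<open>C\<close> to which the upper bound applies.\<close>
  have "0 \<le> ?S" using touching_inf_nonneg[of 1 v] upper[of 1 v] v by (auto intro: order_trans)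
  moreover have "?S \<le> 1" by (auto intro!: SUP_least touching_inf_le_1)
  ultimately obtain C where "?S = ereal C" "0 \<le> C" by (cases ?S) auto
  then show "maximal_op_norm N \<omega> \<le> ?S"
    using maximal_op_norm_le[of C] upper by simp
  show "?S \<le> maximal_op_norm N \<omega>"
    by (auto intro!: SUP_least touching_inf_le_maximal_op_norm)
qed

end

theorem corollary2p14:
  fixes N :: "real ^ 'd \<Rightarrow> real" and \<omega> :: "real \<Rightarrow> real"
  assumes "is_norm N" and "modulus_of_continuity \<omega>"
  shows "maximal_op_norm N \<omega> =
    (SUP t \<in> {0<..}. SUP v \<in> {v. N v = 1}.
       INF (c, R) \<in> {(c, R). 0 < R \<and> R \<le> 1 \<and> N (v - c) = R}.
         ereal (1 / \<omega> t *
           ((LINT u : norm_ball N 0 1 | lebesgue. \<omega> (t * N (c + R *\<^sub>R u))) /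
              measure lebesgue (norm_ball N 0 1))))"
  using maximal_op_norm_eq[OF assms] unfolding touching_inf_def ball_average_def .

end
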